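(* Consider the entropy stable semi-discrete DG scheme for the augmented shallow water moment equations: for elements $k=1,\dots,K$ and nodes $i=0,1,\dots,P$, $$\omega_i \frac{\Delta x_k}{2} \partial_t \mathbf{U}_i^k + \omega_i \sum_{m=0}^P 2\mathcal{D}_{im}\, \mathbf{D}_{\tt EC}^{-}(\mathbf{U}_i^k, \mathbf{U}_m^k) + \delta_{i0}\,\mathbf{D}_{\tt ES}^{+}(\mathbf{U}_P^{k-1}, \mathbf{U}_0^k) + \delta_{iP}\,\mathbf{D}_{\tt ES}^{-}(\mathbf{U}_P^k, \mathbf{U}_0^{k+1}) = \mathbf{0},$$ with the fluctuations $\mathbf{D}_{\tt EC}^\pm$, $\mathbf{D}_{\tt ES}^\pm$ defined in the context. This scheme is well-balanced for the lake-at-rest steady state, i.e. it exactly preserves solutions satisfying the lake-at-rest conditions: if, for some constant $H_0$, all nodal states (including the exterior states used at the domain boundary) belong to $$\mathcal{U}_{\rm wb} = \big\{\boldsymbol{u} :\ h + b = H_0,\ \ h u_m = 0,\ \ h\boldsymbol{\alpha} = \boldsymbol{0},\ \ h > 0 \big\},$$ then $\partial_t\mathbf{U}_i^k=\mathbf{0}$ for all $i=0,\dots,P$ and $k=1,\dots,K$.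
   Context: $N\ge1$, $P\ge1$, $K\ge1$ are integers, $g>0$. A state is $\boldsymbol{u}=(h,hu_m,h\alpha_1,\dots,h\alpha_N,b)^{\rm T}\in\mathbb{R}^{N+3}$ with $h>0$, $\boldsymbol{\alpha}=(\alpha_1,\dots,\alpha_N)^{\rm T}$. For a pair of states, $[\![\varphi]\!]=\varphi^+-\varphi^-$ and $\{\!\{\varphi\}\!\}=\tfrac12(\varphi^++\varphi^-)$. Discretization: the interval $\Omega$ is split into elements of sizes $\Delta x_k>0$; $\mathbf{U}_i^k(t)\in\mathbb{R}^{N+3}$ is the nodal state at the $i$-th Legendre–Gauss–Lobatto node $\xi_i\in[-1,1]$ of element $k$; $\omega_i>0$ are the corresponding LGL quadrature weights; $\mathcal{D}_{im}=l_m'(\xi_i)$ with $l_m$ the Lagrange basis polynomials at the LGL nodes; $\delta$ is the Kronecker delta. For $k=1$ and $k=K$ the neighbouring states $\mathbf{U}_P^{0}$, $\mathbf{U}_0^{K+1}$ are exterior states (e.g. given by periodicity). Coefficients: with $L_i$ the classical Legendre polynomials ($L_i(1)=1$) and $\phi_i(\zeta)=(-1)^iL_i(2\zeta-1)$ on $[0,1]$, $A_{i j k} =(2i+1) \int_0^1 \phi_i \phi_j \phi_k\, {\rm d} \zeta$ and $B_{i j k} = (2 i+1) \int_0^1 \phi_i^{\prime}(\zeta)\big(\int_0^\zeta \phi_j(s)\,{\rm d} s\big) \phi_k(\zeta)\, {\rm d} \zeta$. Flux $\mathbf{f}(\boldsymbol{u})$: $f_1=hu_m$, $f_2=hu_m^2+h\sum_{i=1}^N\frac{\alpha_i^2}{2i+1}$,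 $f_{i+2}=2hu_m\alpha_i+h\sum_{j,k=1}^NA_{ijk}\alpha_j\alpha_k$ ($i=1,\dots,N$), $f_{N+3}=0$. Nonconservative matrix $\mathbf{B}(\boldsymbol{u})$, acting on $q\in\mathbb{R}^{N+3}$: $(\mathbf{B}q)_1=0$, $(\mathbf{B}q)_2=gh(q_1+q_{N+3})$, $(\mathbf{B}q)_{i+2}=-u_mq_{i+2}+\sum_{j,k=1}^NB_{ijk}\alpha_k\,q_{j+2}$ ($i=1,\dots,N$), $(\mathbf{B}q)_{N+3}=0$. Entropy conservative flux $\mathbf{f}^{\tt EC}(\boldsymbol{u}^-,\boldsymbol{u}^+)$: $f^{\tt EC}_1 = \{\!\{hu_m\}\!\}$, $f^{\tt EC}_2 = \{\!\{hu_m\}\!\}\{\!\{u_m\}\!\} + \sum_{j=1}^N \frac{\{\!\{h\alpha_j\}\!\}\{\!\{\alpha_j\}\!\}}{2j+1}$, $f^{\tt EC}_{i+2} = \{\!\{hu_m\}\!\}\{\!\{\alpha_i\}\!\} + \{\!\{h\alpha_i\}\!\}\{\!\{u_m\}\!\} + \sum_{j,k=1}^N A_{ijk}\{\!\{h\alpha_j\}\!\}\{\!\{\alpha_k\}\!\}$ ($i=1,\dots,N$), $f^{\tt EC}_{N+3}=0$. Entropy variables: $w_1=-\frac{u_m^2}{2}-\frac12\sum_{i=1}^N\frac{\alpha_i^2}{2i+1}+g(h+b)$, $w_2=u_m$, $w_{i+2}=\frac{\alpha_i}{2i+1}$ ($i=1,\dots,N$), $w_{N+3}=gh$. Fluctuations: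 $$\mathbf{D}_{\tt EC}^{\pm}(\boldsymbol{u}^-, \boldsymbol{u}^+) = \tfrac{1}{2} \mathbf{B}(\boldsymbol{u}^\pm) [\![\boldsymbol{u}]\!] \pm \left(\mathbf{f}(\boldsymbol{u}^{\pm}) - \mathbf{f}^{\tt EC}(\boldsymbol{u}^-, \boldsymbol{u}^+)\right),$$ $$\mathbf{D}^{\pm}_{\tt ES}(\boldsymbol{u}^-, \boldsymbol{u}^+) = \mathbf{D}^{\pm}_{\tt EC}(\boldsymbol{u}^-, \boldsymbol{u}^+) \pm \tfrac{1}{2}|\lambda|_{\max}\begin{pmatrix}\bar{\mathbf{H}}&\mathbf{0}\\ \mathbf{0}^{\rm T}&0\end{pmatrix}[\![\boldsymbol{w}]\!],$$ where $\bar{\mathbf{H}}=\frac1g\big(\{\!\{\mathbf{y}\}\!\}\{\!\{\mathbf{y}\}\!\}^{\rm T}+\mathrm{diag}(\{\!\{\mathbf{z}\}\!\})\big)\in\mathbb{R}^{(N+2)\times(N+2)}$ with $\mathbf{y}=(1,u_m,\alpha_1,\dots,\alpha_N)^{\rm T}$, $\mathbf{z}=(0,gh,3gh,5gh,\dots,(2N+1)gh)^{\rm T}$, and $|\lambda|_{\max}\ge0$ is the largest absolute value, over the two states, of the numbers $u_m\pm\big(gh+\sum_{i=1}^N\frac{3\alpha_i^2}{2i+1}\big)^{1/2}$ and $u_m$. *)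

theory Defs
  imports
    "HOL-Analysis.Henstock_Kurzweil_Integration"
    "HOL-Computational_Algebra.Polynomial"
    "Jordan_Normal_Form.Matrix"
begin

section \<open>Legendre polynomials and moment coefficients\<close>

text \<open>Rodrigues' formula; the normalization gives the value 1 at 1.\<close>

definition legendre :: "nat \<Rightarrow> real poly" where
  "legendre n = Polynomial.smult (1 / (2 ^ n * fact n)) ((pderiv ^^ n) ([:-1, 0, 1:] ^ n))"

definition shifted_legendre :: "nat \<Rightarrow> real poly" where
  "shifted_legendre i = Polynomial.smult ((-1) ^ i) (pcompose (legendre i) [:-1, 2:])"

definition coeff_A :: "nat \<Rightarrow> nat \<Rightarrow> nat \<Rightarrow> real" where
  "coeff_A i j k = (2 * real i + 1) *
     integral {0..1} (\<lambda>x. poly (shifted_legendre i) x * poly (shifted_legendre j) x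
                        * poly (shifted_legendre k) x)"

definition coeff_B :: "nat \<Rightarrow> nat \<Rightarrow> nat \<Rightarrow> real" where
  "coeff_B i j k = (2 * real i + 1) *
     integral {0..1} (\<lambda>x. poly (pderiv (shifted_legendre i)) x
                        * integral {0..x} (\<lambda>s. poly (shifted_legendre j) s)
                        * poly (shifted_legendre k) x)"


section \<open>Legendre--Gauss--Lobatto collocation\<close>

text \<open>The nodes are the end points of \<open>[-1, 1]\<close> and the zeros of the derivative of the
  \<open>P\<close>-th Legendre polynomial (all of them real, simple and interior), in increasing order.\<close>

definition lgl_nodes :: "nat \<Rightarrow> (nat \<Rightarrow> real) \<Rightarrow> bool" where
  "lgl_nodes P \<xi> \<longleftrightarrow>
     strict_mono_on {0..P} \<xi> \<and>
     \<xi> ` {0..P} = {-1, 1} \<union> {x. poly (pderiv (legendre P)) x = 0}"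

definition lagrange_basis :: "nat \<Rightarrow> (nat \<Rightarrow> real) \<Rightarrow> nat \<Rightarrow> real poly" where
  "lagrange_basis P \<xi> m =
     (\<Prod>j \<in> {0..P} - {m}. Polynomial.smult (1 / (\<xi> m - \<xi> j)) [:- \<xi> j, 1:])"

definition lgl_weights :: "nat \<Rightarrow> (nat \<Rightarrow> real) \<Rightarrow> (nat \<Rightarrow> real) \<Rightarrow> bool" where
  "lgl_weights P \<xi> \<omega> \<longleftrightarrow>
     (\<forall>i \<le> P. \<omega> i = integral {-1..1} (\<lambda>x. poly (lagrange_basis P \<xi> i) x))"

definition deriv_matrix :: "nat \<Rightarrow> (nat \<Rightarrow> real) \<Rightarrow> nat \<Rightarrow> nat \<Rightarrow> real" where
  "deriv_matrix P \<xi> i m = poly (pderiv (lagrange_basis P \<xi> m)) (\<xi> i)"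


section \<open>States\<close>

text \<open>Vectors of dimension \<open>N + 3\<close> are indexed from 0, so that the moments \<open>i = 1, \<dots>, N\<close>
  occupy the positions \<open>2, \<dots>, N + 1\<close>.\<close>

definition stack :: "nat \<Rightarrow> real \<Rightarrow> real \<Rightarrow> (nat \<Rightarrow> real) \<Rightarrow> real \<Rightarrow> real vec" where
  "stack N a b c d =
     vec (N + 3) (\<lambda>j. if j = 0 then a else if j = 1 then b
                      else if j = N + 2 then d else c (j - 1))"

definition height :: "real vec \<Rightarrow> real" where
  "height u = u $ 0"

definition momentum :: "real vec \<Rightarrow> real" where
  "momentum u = u $ 1"

definition h_alpha :: "nat \<Rightarrow> real vec \<Rightarrow> real" where
  "h_alpha i u = u $ (i + 1)"

definition bathymetry :: "nat \<Rightarrow> real vec \<Rightarrow> real" where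
  "bathymetry N u = u $ (N + 2)"

definition velocity :: "real vec \<Rightarrow> real" where
  "velocity u = momentum u / height u"

definition alpha :: "nat \<Rightarrow> real vec \<Rightarrow> real" where
  "alpha i u = h_alpha i u / height u"

definition mean :: "(real vec \<Rightarrow> real) \<Rightarrow> real vec \<Rightarrow> real vec \<Rightarrow> real" where
  "mean \<phi> um up = (\<phi> um + \<phi> up) / 2"

definition lake_at_rest :: "nat \<Rightarrow> real \<Rightarrow> real vec set" where
  "lake_at_rest N H0 =
     {u \<in> carrier_vec (N + 3).
        height u + bathymetry N u = H0 \<and> momentum u = 0 \<and>
        (\<forall>i \<in> {1..N}. h_alpha i u = 0) \<and> height u > 0}"


section \<open>Fluxes, entropy variables and fluctuations\<close>

definition flux :: "nat \<Rightarrow> real vec \<Rightarrow> real vec" where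
  "flux N u = stack N
     (momentum u)
     (height u * (velocity u)\<^sup>2
        + height u * (\<Sum>i = 1..N. (alpha i u)\<^sup>2 / (2 * real i + 1)))
     (\<lambda>i. 2 * momentum u * alpha i u
        + height u * (\<Sum>j = 1..N. \<Sum>k = 1..N. coeff_A i j k * alpha j u * alpha k u))
     0"

text \<open>The action \<open>q \<mapsto> B(u) q\<close> of the nonconservative matrix.\<close>

definition noncons :: "nat \<Rightarrow> real \<Rightarrow> real vec \<Rightarrow> real vec \<Rightarrow> real vec" where
  "noncons N g u q = stack N
     0
     (g * height u * (q $ 0 + q $ (N + 2)))
     (\<lambda>i. - velocity u * q $ (i + 1)
        + (\<Sum>j = 1..N. \<Sum>k = 1..N. coeff_B i j k * alpha k u * q $ (j + 1)))
     0"

definition flux_EC :: "nat \<Rightarrow> real vec \<Rightarrow> real vec \<Rightarrow> real vec" where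
  "flux_EC N um up = stack N
     (mean momentum um up)
     (mean momentum um up * mean velocity um up
        + (\<Sum>j = 1..N. mean (h_alpha j) um up * mean (alpha j) um up / (2 * real j + 1)))
     (\<lambda>i. mean momentum um up * mean (alpha i) um up
        + mean (h_alpha i) um up * mean velocity um up
        + (\<Sum>j = 1..N. \<Sum>k = 1..N.
             coeff_A i j k * mean (h_alpha j) um up * mean (alpha k) um up))
     0"

definition entropy_vars :: "nat \<Rightarrow> real \<Rightarrow> real vec \<Rightarrow> real vec" where
  "entropy_vars N g u = stack N
     (- (velocity u)\<^sup>2 / 2 - 1 / 2 * (\<Sum>i = 1..N. (alpha i u)\<^sup>2 / (2 * real i + 1))
        + g * (height u + bathymetry N u))
     (velocity u)
     (\<lambda>i. alpha i u / (2 * real i + 1))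
     (g * height u)"

definition D_EC_minus :: "nat \<Rightarrow> real \<Rightarrow> real vec \<Rightarrow> real vec \<Rightarrow> real vec" where
  "D_EC_minus N g um up =
     (1 / 2) \<cdot>\<^sub>v noncons N g um (up - um) - (flux N um - flux_EC N um up)"

definition D_EC_plus :: "nat \<Rightarrow> real \<Rightarrow> real vec \<Rightarrow> real vec \<Rightarrow> real vec" where
  "D_EC_plus N g um up =
     (1 / 2) \<cdot>\<^sub>v noncons N g up (up - um) + (flux N up - flux_EC N um up)"

definition wave_speeds :: "nat \<Rightarrow> real \<Rightarrow> real vec \<Rightarrow> real set" where
  "wave_speeds N g u =
     (let c = sqrt (g * height u + (\<Sum>i = 1..N. 3 * (alpha i u)\<^sup>2 / (2 * real i + 1)))
      in {velocity u + c, velocity u - c, velocity u})"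

definition lambda_max :: "nat \<Rightarrow> real \<Rightarrow> real vec \<Rightarrow> real vec \<Rightarrow> real" where
  "lambda_max N g um up = Max (abs ` (wave_speeds N g um \<union> wave_speeds N g up))"

definition y_entry :: "nat \<Rightarrow> real vec \<Rightarrow> real" where
  "y_entry j u = (if j = 0 then 1 else if j = 1 then velocity u else alpha (j - 1) u)"

definition z_entry :: "real \<Rightarrow> nat \<Rightarrow> real vec \<Rightarrow> real" where
  "z_entry g j u = (if j = 0 then 0 else (2 * real j - 1) * g * height u)"

definition H_bar :: "nat \<Rightarrow> real \<Rightarrow> real vec \<Rightarrow> real vec \<Rightarrow> real mat" where
  "H_bar N g um up = (1 / g) \<cdot>\<^sub>m
     (mat (N + 2) (N + 2) (\<lambda>(i, j). mean (y_entry i) um up * mean (y_entry j) um up)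
      + mat (N + 2) (N + 2) (\<lambda>(i, j). if i = j then mean (z_entry g i) um up else 0))"

definition dissipation :: "nat \<Rightarrow> real \<Rightarrow> real vec \<Rightarrow> real vec \<Rightarrow> real vec" where
  "dissipation N g um up =
     (1 / 2 * lambda_max N g um up) \<cdot>\<^sub>v
       (four_block_mat (H_bar N g um up) (0\<^sub>m (N + 2) 1) (0\<^sub>m 1 (N + 2)) (0\<^sub>m 1 1)
          *\<^sub>v (entropy_vars N g up - entropy_vars N g um))"

definition D_ES_minus :: "nat \<Rightarrow> real \<Rightarrow> real vec \<Rightarrow> real vec \<Rightarrow> real vec" where
  "D_ES_minus N g um up = D_EC_minus N g um up - dissipation N g um up"

definition D_ES_plus :: "nat \<Rightarrow> real \<Rightarrow> real vec \<Rightarrow> real vec \<Rightarrow> real vec" where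
  "D_ES_plus N g um up = D_EC_plus N g um up + dissipation N g um up"


section \<open>The semi-discrete scheme\<close>

definition has_vec_derivative ::
    "nat \<Rightarrow> (real \<Rightarrow> real vec) \<Rightarrow> real vec \<Rightarrow> real \<Rightarrow> real set \<Rightarrow> bool" where
  "has_vec_derivative n f D t S \<longleftrightarrow>
     D \<in> carrier_vec n \<and> (\<forall>s \<in> S. f s \<in> carrier_vec n) \<and>
     (\<forall>j < n. ((\<lambda>s. f s $ j) has_real_derivative D $ j) (at t within S))"

text \<open>The scheme at one instant: \<open>U k i\<close> is the nodal state at node \<open>i\<close> of element \<open>k\<close> and
  \<open>dU k i\<close> its time derivative. The elements are \<open>1, \<dots>, K\<close>; the exterior states are
  \<open>U 0 P\<close> and \<open>U (K + 1) 0\<close>, on which the scheme imposes no equation.\<close>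

definition dg_scheme ::
    "nat \<Rightarrow> nat \<Rightarrow> nat \<Rightarrow> real \<Rightarrow> (nat \<Rightarrow> real) \<Rightarrow> (nat \<Rightarrow> real) \<Rightarrow> (nat \<Rightarrow> real) \<Rightarrow>
     (nat \<Rightarrow> nat \<Rightarrow> real vec) \<Rightarrow> (nat \<Rightarrow> nat \<Rightarrow> real vec) \<Rightarrow> bool" where
  "dg_scheme N P K g \<xi> \<omega> \<Delta>x U dU \<longleftrightarrow>
     (\<forall>k \<in> {1..K}. \<forall>i \<in> {0..P}.
        (\<omega> i * (\<Delta>x k / 2)) \<cdot>\<^sub>v dU k i
        + \<omega> i \<cdot>\<^sub>v finsum_vec TYPE(real) (N + 3)
            (\<lambda>m. (2 * deriv_matrix P \<xi> i m) \<cdot>\<^sub>v D_EC_minus N g (U k i) (U k m)) {0..P}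
        + (if i = 0 then 1 else 0) \<cdot>\<^sub>v D_ES_plus N g (U (k - 1) P) (U k 0)
        + (if i = P then 1 else 0) \<cdot>\<^sub>v D_ES_minus N g (U k P) (U (k + 1) 0)
        = 0\<^sub>v (N + 3))"

end

theory Submission
  imports Defs
begin

text \<open>At a lake at rest the water does not move, so velocity, momentum and moments vanish and
  with them both the physical flux and the entropy conservative flux. What is left of an entropy
  conservative fluctuation is the gravity term, which is proportional to
  \<open>h\<^sup>+ + b\<^sup>+ - (h\<^sup>- + b\<^sup>-)\<close>, the jump of the constant free surface. The point of the
  formulation is that gravity is entirely nonconservative here: no pressure \<open>g h\<^sup>2 / 2\<close> sits
  in the flux, where its derivative would have to cancel against the bathymetry term under
  quadrature. Hence the fluctuation vanishes for each pair of states separately (lemmas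
  \<open>D_EC_minus_lake_at_rest\<close> and \<open>D_EC_plus_lake_at_rest\<close>), and so does each summand of
  the volume term.

  The interface dissipation acts on the jump of the entropy variables. The first of these equals
  \<open>g (h + b)\<close> at rest and has no jump; the only one that can jump is the last, \<open>g h\<close>, and it
  meets the zero last column of the dissipation matrix (lemma \<open>dissipation_lake_at_rest\<close>).
  The scheme is then reduced to a positive multiple of the time derivative being zero.\<close>

lemma lake_at_restD:
  assumes "u \<in> lake_at_rest N H0"
  shows "u \<in> carrier_vec (N + 3)" "momentum u = 0" "velocity u = 0"
    "\<And>i. i \<in> {1..N} \<Longrightarrow> h_alpha i u = 0" "\<And>i. i \<in> {1..N} \<Longrightarrow> alpha i u = 0"
    "height u + bathymetry N u = H0"
  using assms
  by (auto simp: lake_at_rest_def velocity_def alpha_def height_def bathymetry_def)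

lemma stack_eq_zero_vec:
  assumes "a = 0" "b = 0" "\<And>i. i \<in> {1..N} \<Longrightarrow> c i = 0" "d = 0"
  shows "stack N a b c d = 0\<^sub>v (N + 3)"
  using assms(1,2,4) by (intro eq_vecI) (auto simp: stack_def intro!: assms(3))

lemma smult_zero_vec: "(c :: 'a :: mult_zero) \<cdot>\<^sub>v 0\<^sub>v n = 0\<^sub>v n"
  by (intro eq_vecI) auto

lemma flux_lake_at_rest:
  assumes "u \<in> lake_at_rest N H0"
  shows "flux N u = 0\<^sub>v (N + 3)"
  unfolding flux_def using lake_at_restD[OF assms] by (intro stack_eq_zero_vec) auto

lemma flux_EC_lake_at_rest:
  assumes "um \<in> lake_at_rest N H0" "up \<in> lake_at_rest N H0"
  shows "flux_EC N um up = 0\<^sub>v (N + 3)"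
  unfolding flux_EC_def using lake_at_restD[OF assms(1)] lake_at_restD[OF assms(2)]
  by (intro stack_eq_zero_vec) (auto simp: mean_def)

text \<open>This is where the free surface being the same constant in both states is used; the
  water heights themselves may differ.\<close>

lemma noncons_jump_lake_at_rest:
  assumes "u \<in> lake_at_rest N H0" "um \<in> lake_at_rest N H0" "up \<in> lake_at_rest N H0"
  shows "noncons N g u (up - um) = 0\<^sub>v (N + 3)"
proof -
  note at_rest = lake_at_restD[OF assms(1)] lake_at_restD[OF assms(2)] lake_at_restD[OF assms(3)]
  have "(up - um) $ 0 + (up - um) $ (N + 2) = 0"
    using at_rest by (simp add: height_def bathymetry_def)
  then show ?thesis
    unfolding noncons_def using at_rest by (intro stack_eq_zero_vec) auto
qed

lemma D_EC_minus_lake_at_rest: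
  assumes "um \<in> lake_at_rest N H0" "up \<in> lake_at_rest N H0"
  shows "D_EC_minus N g um up = 0\<^sub>v (N + 3)"
  using assms
  by (simp add: D_EC_minus_def noncons_jump_lake_at_rest flux_lake_at_rest
      flux_EC_lake_at_rest smult_zero_vec)

lemma D_EC_plus_lake_at_rest:
  assumes "um \<in> lake_at_rest N H0" "up \<in> lake_at_rest N H0"
  shows "D_EC_plus N g um up = 0\<^sub>v (N + 3)"
  using assms
  by (simp add: D_EC_plus_def noncons_jump_lake_at_rest flux_lake_at_rest
      flux_EC_lake_at_rest smult_zero_vec)

lemma entropy_vars_jump_lake_at_rest:
  assumes "um \<in> lake_at_rest N H0" "up \<in> lake_at_rest N H0" and "j < N + 2"
  shows "(entropy_vars N g up - entropy_vars N g um) $ j = 0"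
proof -
  have "entropy_vars N g u $ j = (if j = 0 then g * H0 else 0)" if "u \<in> lake_at_rest N H0" for u
    using lake_at_restD(3,6)[OF that] \<open>j < N + 2\<close>
    by (auto simp: entropy_vars_def stack_def
        intro!: sum.neutral lake_at_restD(5)[OF that])
  then show ?thesis
    using assms by (simp add: entropy_vars_def stack_def)
qed

text \<open>A vector supported in the last coordinate lies in the kernel of a block matrix whose
  last column is zero.\<close>

lemma dissipation_lake_at_rest:
  assumes "um \<in> lake_at_rest N H0" "up \<in> lake_at_rest N H0"
  shows "dissipation N g um up = 0\<^sub>v (N + 3)"
proof -
  define M where
    "M = four_block_mat (H_bar N g um up) (0\<^sub>m (N + 2) 1) (0\<^sub>m 1 (N + 2)) (0\<^sub>m 1 1)"
  define w where "w = entropy_vars N g up - entropy_vars N g um"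
  have H: "dim_row (H_bar N g um up) = N + 2" "dim_col (H_bar N g um up) = N + 2"
    by (simp_all add: H_bar_def)
  have dims: "dim_row M = N + 3" "dim_col M = N + 3" "dim_vec w = N + 3"
    using H by (simp_all add: M_def w_def entropy_vars_def stack_def)
  have "M $$ (i, j) * w $ j = 0" if "i < N + 3" "j < N + 3" for i j
  proof (cases "j < N + 2")
    case True
    then show ?thesis
      using entropy_vars_jump_lake_at_rest[OF assms] by (simp add: w_def)
  next
    case False
    then show ?thesis
      using that H by (simp add: M_def)
  qed
  then have "M *\<^sub>v w = 0\<^sub>v (N + 3)"
    using dims by (intro eq_vecI) (auto simp: scalar_prod_def intro!: sum.neutral)
  then show ?thesis
    by (simp add: dissipation_def M_def w_def smult_zero_vec)
qed

lemma finsum_vec_zero_vec: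
  assumes "\<And>m. m \<in> A \<Longrightarrow> f m = 0\<^sub>v n"
  shows "finsum_vec TYPE('a :: comm_ring_1) n f A = 0\<^sub>v n"
proof -
  interpret comm_monoid "monoid_vec TYPE('a) n"
    by (rule comm_monoid_vec)
  have "finprod (monoid_vec TYPE('a) n) f A = \<one>\<^bsub>monoid_vec TYPE('a) n\<^esub>"
    using assms by (intro finprod_one_eqI) (simp add: monoid_vec_simps)
  then show ?thesis
    by (simp add: finsum_vec_def monoid_vec_simps)
qed

theorem lemma6:
  fixes N P K :: nat
    and g H0 T t :: real
    and \<xi> \<omega> \<Delta>x :: "nat \<Rightarrow> real"
    and U :: "nat \<Rightarrow> nat \<Rightarrow> real \<Rightarrow> real vec"
    and dU :: "nat \<Rightarrow> nat \<Rightarrow> real vec"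
  assumes "N \<ge> 1" and "P \<ge> 1" and "K \<ge> 1" and "g > 0"
    and "lgl_nodes P \<xi>"
    and "lgl_weights P \<xi> \<omega>"
    and "\<And>i. i \<in> {0..P} \<Longrightarrow> \<omega> i > 0"
    and "\<And>k. k \<in> {1..K} \<Longrightarrow> \<Delta>x k > 0"
    and "T > 0" and "t \<in> {0..T}"
    and deriv: "\<And>k i. k \<in> {1..K} \<Longrightarrow> i \<in> {0..P} \<Longrightarrow>
           has_vec_derivative (N + 3) (U k i) (dU k i) t {0..T}"
    and scheme: "dg_scheme N P K g \<xi> \<omega> \<Delta>x (\<lambda>k i. U k i t) dU"
    and interior: "\<And>k i. k \<in> {1..K} \<Longrightarrow> i \<in> {0..P} \<Longrightarrow> U k i t \<in> lake_at_rest N H0"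
    and exterior: "U 0 P t \<in> lake_at_rest N H0" "U (K + 1) 0 t \<in> lake_at_rest N H0"
  shows "\<forall>k \<in> {1..K}. \<forall>i \<in> {0..P}. dU k i = 0\<^sub>v (N + 3)"
proof (intro ballI)
  fix k i
  assume k: "k \<in> {1..K}" and i: "i \<in> {0..P}"
  have left: "U (k - 1) P t \<in> lake_at_rest N H0"
    using interior[of "k - 1" P] exterior(1) k by (cases "k = 1") (auto simp: Suc_le_eq)
  have right: "U (k + 1) 0 t \<in> lake_at_rest N H0"
    using interior[of "k + 1" 0] exterior(2) k by (cases "k = K") auto
  have volume: "finsum_vec TYPE(real) (N + 3)
      (\<lambda>m. (2 * deriv_matrix P \<xi> i m) \<cdot>\<^sub>v D_EC_minus N g (U k i t) (U k m t)) {0..P}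
      = 0\<^sub>v (N + 3)"
    using D_EC_minus_lake_at_rest[OF interior[OF k i] interior[OF k]]
    by (intro finsum_vec_zero_vec) (simp add: smult_zero_vec)
  have interfaces: "D_ES_plus N g (U (k - 1) P t) (U k 0 t) = 0\<^sub>v (N + 3)"
    "D_ES_minus N g (U k P t) (U (k + 1) 0 t) = 0\<^sub>v (N + 3)"
    using left right interior[OF k, of 0] interior[OF k, of P]
    by (simp_all add: D_ES_plus_def D_ES_minus_def D_EC_plus_lake_at_rest
        D_EC_minus_lake_at_rest dissipation_lake_at_rest)
  have dim: "dU k i \<in> carrier_vec (N + 3)"
    using deriv[OF k i] by (simp add: has_vec_derivative_def)
  define c where "c = \<omega> i * (\<Delta>x k / 2)"
  have "c \<noteq> 0"
    using assms(7)[OF i] assms(8)[OF k] by (simp add: c_def)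
  have "c \<cdot>\<^sub>v dU k i + \<omega> i \<cdot>\<^sub>v 0\<^sub>v (N + 3) + (if i = 0 then 1 else 0) \<cdot>\<^sub>v 0\<^sub>v (N + 3)
      + (if i = P then 1 else 0) \<cdot>\<^sub>v 0\<^sub>v (N + 3) = 0\<^sub>v (N + 3)"
    using scheme[unfolded dg_scheme_def, rule_format, OF k i]
    unfolding volume interfaces c_def .
  then have "c \<cdot>\<^sub>v dU k i = 0\<^sub>v (N + 3)"
    using dim by (simp add: smult_zero_vec)
  then have "c * dU k i $ j = 0" if "j < N + 3" for j
    using dim that by (metis carrier_vecD index_smult_vec(1) index_zero_vec(1))
  then show "dU k i = 0\<^sub>v (N + 3)"
    using dim \<open>c \<noteq> 0\<close> by (intro eq_vecI) auto
qed

end
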